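(* Let $d\ge1$. For any finitely presentable persistence modules $M,N:\mathbb{R}^d\to\mathrm{vect}_k$ and any nonempty $\mathcal{I}\subset\mathrm{Int}(\mathbb{R}^d)$, $$\hat d_{\mathrm{E}}\big((\mathrm{dgm}_M,\mathcal{I}),(\mathrm{dgm}_N,\mathcal{I})\big)\le d_{\mathrm{I}}(M,N),$$ where $d_{\mathrm{I}}(M,N)$ is the interleaving distance between $M$ and $N$.
   Context: Fix a field $k$; $\mathrm{vect}_k$ is the category of finite-dimensional $k$-vector spaces. $\mathbb{R}^d$ carries the product partial order and is regarded as a category. A persistence module over $\mathbb{R}^d$ is a functor $M:\mathbb{R}^d\to\mathrm{vect}_k$. An interval of a poset $P$ is a nonempty subset $I\subseteq P$ that is convex ($p,q\in I$, $p\le r\le q$ imply $r\in I$) and connected (any two elements of $I$ are joined by a finite sequence in $I$ whose consecutive terms are comparable). $\mathrm{Int}(P)$ is the set of intervals of $P$. For $I\in\mathrm{Int}(P)$, the interval module $k_I$ is $k$ on $I$, $0$ elsewhere, with identity maps within $I$ and zero maps otherwise. For $p\in P$, $p^\uparrow=\{q:p\le q\}$. $M$ is finitely presentable if it is isomorphic to the cokernel of a morphism $\bigoplus_{a\in A}k_{a^\uparrow}\to\bigoplus_{b\in B}k_{b^\uparrow}$ with $A,B$ finite multisets of elements of $P$. The generalized rank of a persistence module over a connected poset is the rank of the canonical map from its limit to its colimit. For $I\in\mathrm{Int}(\mathbb{R}^d)$, $\mathrm{rk}_M(I)$ is the generalized rank of the restriction $M|_I$. The generalized persistence diagram $\mathrm{dgm}_M:\mathrm{Int}(\mathbb{R}^d)\to\mathbb{Z}$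 is the unique function with $\mathrm{rk}_M(I)=\sum_{J\supseteq I}\mathrm{dgm}_M(J)$ for all $I\in\mathrm{Int}(\mathbb{R}^d)$; it exists for finitely presentable $M$, and $\mathrm{dgm}_M$ and $\mathrm{rk}_M$ determine each other. For $\epsilon\ge 0$, the $\epsilon$-thickening of $I$ is $I^\epsilon=\{q\in\mathbb{R}^d: \exists p\in I,\ \|p-q\|_\infty\le\epsilon\}$. A correspondence between nonempty sets $A,B$ is a subset $\mathcal{R}\subset A\times B$ whose projections to $A$ and to $B$ are surjective. An $\epsilon$-correspondence between nonempty $\mathcal{I},\mathcal{J}\subset\mathrm{Int}(\mathbb{R}^d)$ is a correspondence $\mathcal{R}\subset\mathcal{I}\times\mathcal{J}$ such that $J\subset I^\epsilon$ and $I\subset J^\epsilon$ for all $(I,J)\in\mathcal{R}$. The sparse erosion distance $\hat d_{\mathrm{E}}\big((\mathrm{dgm}_M,\mathcal{I}),(\mathrm{dgm}_N,\mathcal{J})\big)$ is the infimum of all $\epsilon>0$ for which there exists an $\epsilon$-correspondence $\mathcal{R}\subset\mathcal{I}\times\mathcal{J}$ such that for all $(I,J)\in\mathcal{R}$ and all $\delta\ge0$: $\mathrm{rk}_N(J^{\epsilon+\delta})\le\mathrm{rk}_M(I^\delta)$ and $\mathrm{rk}_M(I^{\epsilon+\delta})\le\mathrm{rk}_N(J^\delta)$ (infimum of the empty set is $+\infty$). The interleaving distance: for $\epsilon\ge0$ let $M(\epsilon)$ be the shifted module $M(\epsilon)(p)=M(p+\epsilon(1,\dots,1))$. $M$ and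 $N$ are $\epsilon$-interleaved if there are natural transformations $f:M\to N(\epsilon)$, $g:N\to M(\epsilon)$ such that $g(\epsilon)\circ f$ and $f(\epsilon)\circ g$ are the internal maps $M\to M(2\epsilon)$ and $N\to N(2\epsilon)$; $d_{\mathrm{I}}(M,N)$ is the infimum of such $\epsilon$ ($+\infty$ if there is none). *)

theory Defs
  imports
    "HOL-Analysis.Cartesian_Euclidean_Space"
    "HOL-Library.Extended_Real"
    "HOL-Algebra.AbelCoset"
    "Jordan_Normal_Form.Missing_VectorSpace"
begin

section \<open>Vector spaces: families, direct sums, quotients, rank\<close>

text \<open>
  Vector spaces are the records of \<^locale>\<open>vectorspace\<close>. These records extend ring records;
  the fields \<open>mult\<close> and \<open>one\<close> play no role for a vector space and are left undefined.
\<close>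

definition family_space ::
    "'i set \<Rightarrow> ('i \<Rightarrow> ('a, 'b) module) \<Rightarrow> ('i \<Rightarrow> 'b) set \<Rightarrow> ('a, 'i \<Rightarrow> 'b) module" where
  "family_space S V C =
     \<lparr>carrier = C,
      mult = undefined,
      one = undefined,
      zero = (\<lambda>i\<in>S. \<zero>\<^bsub>V i\<^esub>),
      add = (\<lambda>x y. \<lambda>i\<in>S. x i \<oplus>\<^bsub>V i\<^esub> y i),
      smult = (\<lambda>c x. \<lambda>i\<in>S. c \<odot>\<^bsub>V i\<^esub> x i)\<rparr>"

definition direct_sum_space ::
    "'i set \<Rightarrow> ('i \<Rightarrow> ('a, 'b) module) \<Rightarrow> ('a, 'i \<Rightarrow> 'b) module" where
  "direct_sum_space S V =
     family_space S V
       {x \<in> (\<Pi>\<^sub>E i\<in>S. carrier (V i)). finite {i \<in> S. x i \<noteq> \<zero>\<^bsub>V i\<^esub>}}"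

definition inclusion ::
    "'i set \<Rightarrow> ('i \<Rightarrow> ('a, 'b) module) \<Rightarrow> 'i \<Rightarrow> 'b \<Rightarrow> ('i \<Rightarrow> 'b)" where
  "inclusion S V i v = (\<lambda>j\<in>S. if j = i then v else \<zero>\<^bsub>V j\<^esub>)"

text \<open>
  In \<open>quotient_space\<close>, for a coset \<open>X = W + v\<close> the set \<open>W + c X\<close> is the coset \<open>W + c v\<close>
  (the summand \<open>W\<close> matters for \<open>c = 0\<close>).
\<close>

definition quotient_space :: "('a, 'b) module \<Rightarrow> 'b set \<Rightarrow> ('a, 'b set) module" where
  "quotient_space V W =
     \<lparr>carrier = a_rcosets\<^bsub>V\<^esub> W,
      mult = undefined,
      one = undefined,
      zero = W,
      add = (\<lambda>X Y. X <+>\<^bsub>V\<^esub> Y),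
      smult = (\<lambda>c X. W <+>\<^bsub>V\<^esub> ((\<lambda>v. c \<odot>\<^bsub>V\<^esub> v) ` X))\<rparr>"

definition linear_rank ::
    "('a, 'm) ring_scheme \<Rightarrow> ('a, 'b) module \<Rightarrow> ('a, 'c) module \<Rightarrow> ('b \<Rightarrow> 'c) \<Rightarrow> nat" where
  "linear_rank K V W T = vectorspace.dim K (W\<lparr>carrier := T ` carrier V\<rparr>)"


section \<open>Persistence modules over a poset\<close>

record ('p, 'a, 'b) pers =
  obj :: "'p \<Rightarrow> ('a, 'b) module"
  mor :: "'p \<Rightarrow> 'p \<Rightarrow> 'b \<Rightarrow> 'b"

locale persistence_module =
  fixes K :: "('a, 'm) ring_scheme" and M :: "('p::order, 'a, 'b) pers"
  assumes field: "field K"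
    and vs: "vectorspace K (obj M p)"
    and fin_dim: "vectorspace.fin_dim K (obj M p)"
    and hom: "p \<le> q \<Longrightarrow> mor M p q \<in> module_hom K (obj M p) (obj M q)"
    and ident: "x \<in> carrier (obj M p) \<Longrightarrow> mor M p p x = x"
    and comp: "\<lbrakk>p \<le> q; q \<le> r; x \<in> carrier (obj M p)\<rbrakk>
                 \<Longrightarrow> mor M q r (mor M p q x) = mor M p r x"

definition natural_transformation ::
    "('a, 'm) ring_scheme \<Rightarrow> ('p::order, 'a, 'b) pers \<Rightarrow> ('p, 'a, 'c) pers
      \<Rightarrow> ('p \<Rightarrow> 'b \<Rightarrow> 'c) \<Rightarrow> bool" where
  "natural_transformation K M N f \<longleftrightarrow>
     (\<forall>p. f p \<in> module_hom K (obj M p) (obj N p)) \<and>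
     (\<forall>p q. p \<le> q \<longrightarrow> (\<forall>x \<in> carrier (obj M p). f q (mor M p q x) = mor N p q (f p x)))"

definition isomorphic_pers ::
    "('a, 'm) ring_scheme \<Rightarrow> ('p::order, 'a, 'b) pers \<Rightarrow> ('p, 'a, 'c) pers \<Rightarrow> bool" where
  "isomorphic_pers K M N \<longleftrightarrow>
     (\<exists>f. natural_transformation K M N f \<and>
          (\<forall>p. bij_betw (f p) (carrier (obj M p)) (carrier (obj N p))))"


section \<open>Intervals, interval modules and finite presentability\<close>

definition poset_convex :: "'p::order set \<Rightarrow> bool" where
  "poset_convex I \<longleftrightarrow> (\<forall>p\<in>I. \<forall>q\<in>I. \<forall>r. p \<le> r \<and> r \<le> q \<longrightarrow> r \<in> I)"

definition poset_connected :: "'p::order set \<Rightarrow> bool" where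
  "poset_connected I \<longleftrightarrow>
     (\<forall>p\<in>I. \<forall>q\<in>I. (\<lambda>x y. x \<in> I \<and> y \<in> I \<and> (x \<le> y \<or> y \<le> x))\<^sup>*\<^sup>* p q)"

definition Intervals :: "'p::order set set" where
  "Intervals = {I. I \<noteq> {} \<and> poset_convex I \<and> poset_connected I}"

definition interval_module ::
    "('a, 'm) ring_scheme \<Rightarrow> 'p::order set \<Rightarrow> ('p, 'a, 'a) pers" where
  "interval_module K I =
     \<lparr>obj = (\<lambda>p. \<lparr>carrier = (if p \<in> I then carrier K else {\<zero>\<^bsub>K\<^esub>}),
                   mult = undefined,
                   one = undefined,
                   zero = \<zero>\<^bsub>K\<^esub>,
                   add = (\<lambda>x y. x \<oplus>\<^bsub>K\<^esub> y),
                   smult = (\<lambda>c x. c \<otimes>\<^bsub>K\<^esub> x)\<rparr>),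
      mor = (\<lambda>p q x. if p \<in> I \<and> q \<in> I then x else \<zero>\<^bsub>K\<^esub>)\<rparr>"

definition direct_sum_pers ::
    "'i set \<Rightarrow> ('i \<Rightarrow> ('p::order, 'a, 'b) pers) \<Rightarrow> ('p, 'a, 'i \<Rightarrow> 'b) pers" where
  "direct_sum_pers S P =
     \<lparr>obj = (\<lambda>p. direct_sum_space S (\<lambda>i. obj (P i) p)),
      mor = (\<lambda>p q x. \<lambda>i\<in>S. mor (P i) p q (x i))\<rparr>"

definition cokernel_pers ::
    "('p::order, 'a, 'b) pers \<Rightarrow> ('p, 'a, 'c) pers \<Rightarrow> ('p \<Rightarrow> 'b \<Rightarrow> 'c) \<Rightarrow> ('p, 'a, 'c set) pers" where
  "cokernel_pers F G f =
     \<lparr>obj = (\<lambda>p. quotient_space (obj G p) (f p ` carrier (obj F p))),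
      mor = (\<lambda>p q X. (f q ` carrier (obj F q)) <+>\<^bsub>obj G q\<^esub> (mor G p q ` X))\<rparr>"

text \<open>A list enumerates a finite multiset of points of the poset.\<close>

definition free_pers :: "('a, 'm) ring_scheme \<Rightarrow> 'p::order list \<Rightarrow> ('p, 'a, nat \<Rightarrow> 'a) pers" where
  "free_pers K as = direct_sum_pers {..<length as} (\<lambda>i. interval_module K {as ! i..})"

definition finitely_presentable ::
    "('a, 'm) ring_scheme \<Rightarrow> ('p::order, 'a, 'b) pers \<Rightarrow> bool" where
  "finitely_presentable K M \<longleftrightarrow>
     (\<exists>as bs f. natural_transformation K (free_pers K as) (free_pers K bs) f \<and>
                isomorphic_pers K M (cokernel_pers (free_pers K as) (free_pers K bs) f))"


section \<open>Generalized rank and generalized persistence diagram\<close>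

definition limit_space :: "('p::order, 'a, 'b) pers \<Rightarrow> 'p set \<Rightarrow> ('a, 'p \<Rightarrow> 'b) module" where
  "limit_space M S =
     family_space S (obj M)
       {x \<in> (\<Pi>\<^sub>E p\<in>S. carrier (obj M p)). \<forall>p\<in>S. \<forall>q\<in>S. p \<le> q \<longrightarrow> mor M p q (x p) = x q}"

definition colimit_relations ::
    "('a, 'm) ring_scheme \<Rightarrow> ('p::order, 'a, 'b) pers \<Rightarrow> 'p set \<Rightarrow> ('p \<Rightarrow> 'b) set" where
  "colimit_relations K M S =
     LinearCombinations.module.span K (direct_sum_space S (obj M))
       {inclusion S (obj M) p x \<ominus>\<^bsub>direct_sum_space S (obj M)\<^esub> inclusion S (obj M) q (mor M p q x)
         | p q x. p \<in> S \<and> q \<in> S \<and> p \<le> q \<and> x \<in> carrier (obj M p)}"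

definition colimit_space ::
    "('a, 'm) ring_scheme \<Rightarrow> ('p::order, 'a, 'b) pers \<Rightarrow> 'p set \<Rightarrow> ('a, ('p \<Rightarrow> 'b) set) module" where
  "colimit_space K M S = quotient_space (direct_sum_space S (obj M)) (colimit_relations K M S)"

text \<open>
  The canonical map from the limit to the colimit is the composite of the projection to and the
  structure map from the value at any point \<open>p\<close>; for connected \<open>S\<close> it does not depend on \<open>p\<close>.
\<close>

definition limit_to_colimit ::
    "('a, 'm) ring_scheme \<Rightarrow> ('p::order, 'a, 'b) pers \<Rightarrow> 'p set \<Rightarrow> ('p \<Rightarrow> 'b) \<Rightarrow> ('p \<Rightarrow> 'b) set" where
  "limit_to_colimit K M S x =
     (let p = (SOME p. p \<in> S)
      in colimit_relations K M S +>\<^bsub>direct_sum_space S (obj M)\<^esub> inclusion S (obj M) p (x p))"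

definition gen_rank ::
    "('a, 'm) ring_scheme \<Rightarrow> ('p::order, 'a, 'b) pers \<Rightarrow> 'p set \<Rightarrow> nat" where
  "gen_rank K M S =
     linear_rank K (limit_space M S) (colimit_space K M S) (limit_to_colimit K M S)"

text \<open>
  \<open>is_gen_diagram r D\<close>: \<open>D\<close> is the generalized persistence diagram belonging to the rank
  function \<open>r\<close>. The sum over \<open>J \<supseteq> I\<close> is required to have finite support.
\<close>

definition is_gen_diagram :: "('p::order set \<Rightarrow> nat) \<Rightarrow> ('p set \<Rightarrow> int) \<Rightarrow> bool" where
  "is_gen_diagram r D \<longleftrightarrow>
     (\<forall>I\<in>Intervals. finite {J \<in> Intervals. I \<subseteq> J \<and> D J \<noteq> 0} \<and>
        int (r I) = (\<Sum>J | J \<in> Intervals \<and> I \<subseteq> J \<and> D J \<noteq> 0. D J))"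

lemma gen_diagram_determines_rank:
  assumes "is_gen_diagram r D" "is_gen_diagram s D" "I \<in> Intervals"
  shows "r I = s I"
  using assms unfolding is_gen_diagram_def by (metis of_nat_eq_iff)

lemma rank_determines_gen_diagram:
  assumes D: "is_gen_diagram r D" and E: "is_gen_diagram r E" and I: "I \<in> Intervals"
  shows "D I = E I"
proof (rule ccontr)
  assume neq: "D I \<noteq> E I"
  define A where "A = {J \<in> Intervals. I \<subseteq> J \<and> D J \<noteq> E J}"
  have "A \<subseteq> {J \<in> Intervals. I \<subseteq> J \<and> D J \<noteq> 0} \<union> {J \<in> Intervals. I \<subseteq> J \<and> E J \<noteq> 0}"
    unfolding A_def by auto
  with D E I have "finite A"
    unfolding is_gen_diagram_def by (meson finite_UnI finite_subset)
  moreover have "I \<in> A" using neq I by (simp add: A_def)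
  ultimately obtain J where J: "J \<in> A" and max: "\<And>L. L \<in> A \<Longrightarrow> J \<subseteq> L \<Longrightarrow> L = J"
    by (metis finite_has_maximal2)
  have JI: "J \<in> Intervals" "I \<subseteq> J" "D J \<noteq> E J" using J by (auto simp: A_def)
  define U where "U = {L \<in> Intervals. J \<subseteq> L \<and> D L \<noteq> 0} \<union> {L \<in> Intervals. J \<subseteq> L \<and> E L \<noteq> 0} \<union> {J}"
  have fin: "finite U"
    using D E JI(1) unfolding is_gen_diagram_def U_def by auto
  have "int (r J) = sum D U"
    using D JI(1) fin unfolding is_gen_diagram_def U_def
    by (fastforce intro: sum.mono_neutral_left)
  moreover have "int (r J) = sum E U"
    using E JI(1) fin unfolding is_gen_diagram_def U_def
    by (fastforce intro: sum.mono_neutral_left)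
  moreover have "sum D (U - {J}) = sum E (U - {J})"
  proof (rule sum.cong)
    fix L assume "L \<in> U - {J}"
    then show "D L = E L"
      using max[of L] JI by (auto simp: U_def A_def)
  qed simp
  moreover have "J \<in> U" by (simp add: U_def)
  ultimately show False
    using JI(3) fin by (simp add: sum.remove)
qed


section \<open>Sparse erosion distance and interleaving distance\<close>

definition thickening :: "real \<Rightarrow> (real ^ 'd) set \<Rightarrow> (real ^ 'd) set" where
  "thickening \<epsilon> I = {q. \<exists>p\<in>I. infnorm (p - q) \<le> \<epsilon>}"

definition correspondence :: "'i set \<Rightarrow> 'j set \<Rightarrow> ('i \<times> 'j) set \<Rightarrow> bool" where
  "correspondence A B R \<longleftrightarrow> R \<subseteq> A \<times> B \<and> fst ` R = A \<and> snd ` R = B"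

definition eps_correspondence ::
    "real \<Rightarrow> (real ^ 'd) set set \<Rightarrow> (real ^ 'd) set set
      \<Rightarrow> ((real ^ 'd) set \<times> (real ^ 'd) set) set \<Rightarrow> bool" where
  "eps_correspondence \<epsilon> \<I> \<J> R \<longleftrightarrow>
     correspondence \<I> \<J> R \<and> (\<forall>(I, J)\<in>R. J \<subseteq> thickening \<epsilon> I \<and> I \<subseteq> thickening \<epsilon> J)"

text \<open>
  A generalized persistence diagram enters the sparse erosion distance through its rank function
  only, and the two determine each other on intervals (\<open>rank_determines_gen_diagram\<close>,
  \<open>gen_diagram_determines_rank\<close>). The pair of a diagram and a set of intervals is
  therefore represented by the pair of the rank function and the set of intervals.

  The rank functions are evaluated at thickenings of intervals. For \<open>d \<ge> 3\<close> such a thickening is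
  connected but can fail to be convex; its generalized rank is still that of the restriction to
  a connected subposet, which is why rank functions are defined on arbitrary subsets.
\<close>

definition sparse_erosion_distance ::
    "((real ^ 'd) set \<Rightarrow> nat) \<times> (real ^ 'd) set set
      \<Rightarrow> ((real ^ 'd) set \<Rightarrow> nat) \<times> (real ^ 'd) set set \<Rightarrow> ereal" where
  "sparse_erosion_distance = (\<lambda>(rk\<^sub>M, \<I>) (rk\<^sub>N, \<J>).
     Inf {ereal \<epsilon> | \<epsilon>. \<epsilon> > 0 \<and>
       (\<exists>R. eps_correspondence \<epsilon> \<I> \<J> R \<and>
          (\<forall>(I, J)\<in>R. \<forall>\<delta>\<ge>0.
             rk\<^sub>N (thickening (\<epsilon> + \<delta>) J) \<le> rk\<^sub>M (thickening \<delta> I) \<and>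
             rk\<^sub>M (thickening (\<epsilon> + \<delta>) I) \<le> rk\<^sub>N (thickening \<delta> J)))})"

definition shift :: "real \<Rightarrow> (real ^ 'd, 'a, 'b) pers \<Rightarrow> (real ^ 'd, 'a, 'b) pers" where
  "shift \<epsilon> M =
     \<lparr>obj = (\<lambda>p. obj M (p + \<epsilon> *\<^sub>R 1)),
      mor = (\<lambda>p q. mor M (p + \<epsilon> *\<^sub>R 1) (q + \<epsilon> *\<^sub>R 1))\<rparr>"

definition interleaved ::
    "('a, 'm) ring_scheme \<Rightarrow> real \<Rightarrow> (real ^ 'd, 'a, 'b) pers \<Rightarrow> (real ^ 'd, 'a, 'c) pers \<Rightarrow> bool" where
  "interleaved K \<epsilon> M N \<longleftrightarrow>
     (\<exists>f g. natural_transformation K M (shift \<epsilon> N) f \<and>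
            natural_transformation K N (shift \<epsilon> M) g \<and>
            (\<forall>p. \<forall>x \<in> carrier (obj M p).
               g (p + \<epsilon> *\<^sub>R 1) (f p x) = mor M p (p + (2 * \<epsilon>) *\<^sub>R 1) x) \<and>
            (\<forall>p. \<forall>y \<in> carrier (obj N p).
               f (p + \<epsilon> *\<^sub>R 1) (g p y) = mor N p (p + (2 * \<epsilon>) *\<^sub>R 1) y))"

definition interleaving_distance ::
    "('a, 'm) ring_scheme \<Rightarrow> (real ^ 'd, 'a, 'b) pers \<Rightarrow> (real ^ 'd, 'a, 'c) pers \<Rightarrow> ereal" where
  "interleaving_distance K M N = Inf {ereal \<epsilon> | \<epsilon>. \<epsilon> \<ge> 0 \<and> interleaved K \<epsilon> M N}"

end

theory Submission
  imports Defs
begin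

text \<open>
  The witness for the erosion distance is the diagonal correspondence on the given set of intervals. So
  everything rests on one inequality of generalized ranks: if \<open>M\<close> and \<open>N\<close> are \<open>\<epsilon>\<close>-interleaved, then the
  rank of \<open>N\<close> over \<open>B\<close>, the thickening of an interval by \<open>\<epsilon>' + \<delta>\<close> with \<open>\<epsilon>' \<ge> \<epsilon>\<close>, is at most the rank of
  \<open>M\<close> over \<open>A\<close>, its thickening by \<open>\<delta>\<close>. The other inequality follows by exchanging \<open>M\<close> and \<open>N\<close>.

  For this inequality, note that \<open>p - \<epsilon>(1,\<dots>,1)\<close> and \<open>p + \<epsilon>(1,\<dots>,1)\<close> lie in \<open>B\<close> for each \<open>p \<in> A\<close>. The
  interleaving therefore induces maps \<open>lim N|B \<rightarrow> lim M|A\<close> and \<open>colim M|A \<rightarrow> colim N|B\<close>. The composite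
  \<open>lim N|B \<rightarrow> lim M|A \<rightarrow> colim M|A \<rightarrow> colim N|B\<close> takes a compatible family \<open>x\<close> to the class of its
  member at \<open>p + \<epsilon>(1,\<dots>,1)\<close>, because the two maps of the interleaving compose to an internal map of
  \<open>N\<close>. As \<open>B\<close> is connected, this is the canonical map of \<open>N\<close> over \<open>B\<close>. So that map factors through the
  canonical map of \<open>M\<close> over \<open>A\<close>, and its rank is not larger
  (\<open>gen_rank_le_of_factorization\<close>, \<open>gen_rank_le_of_interleaved\<close>).

  Ranks are well behaved here although limits and colimits over infinite posets can be
  infinite-dimensional: the canonical map passes through the finite-dimensional value of the module at
  one point (\<open>image_limit_to_colimit_fin_dim\<close>).
\<close>

section \<open>Rank and factorization of linear maps\<close>

lemma linear_mapI:
  assumes "vectorspace K V" "vectorspace K W" "T \<in> module_hom K V W"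
  shows "linear_map K V W T"
  using assms by (auto simp: linear_map_def mod_hom_def mod_hom_axioms_def vectorspace_def)

lemma vectorspaceD:
  assumes "vectorspace K V"
  shows "Module.module K V" and "abelian_group V" and "abelian_monoid V"
  using assms by (auto simp: vectorspace_def Module.module_def abelian_group_def)

lemma module_hom_comp:
  assumes "S \<in> module_hom K U V" "T \<in> module_hom K V W"
  shows "(\<lambda>x. T (S x)) \<in> module_hom K U W"
  using assms by (auto simp: module_hom_def Pi_def)

text \<open>
  Linear independence does not depend on the ambient space, so the dimension of the whole space bounds
  the size of the independent sets of a subspace. A maximal one among them is a finite basis.
\<close>

lemma subspace_finite_dimensional:
  assumes V: "vectorspace K V" and fin: "vectorspace.fin_dim K V" and X: "subspace K X V"
  shows "vectorspace.fin_dim K (V\<lparr>carrier := X\<rparr>)"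
    and "vectorspace.dim K (V\<lparr>carrier := X\<rparr>) \<le> vectorspace.dim K V"
proof -
  interpret V: vectorspace K V by fact
  let ?X = "V\<lparr>carrier := X\<rparr>"
  interpret X: vectorspace K ?X using V.subspace_is_vs[OF X] .
  have sub: "submodule K X V" using X by (simp add: subspace_def)
  then have XV: "X \<subseteq> carrier V" by (simp add: submodule_def)
  have bound: "finite A \<and> card A \<le> V.dim" if "A \<subseteq> carrier ?X \<and> X.lin_indpt A" for A
  proof -
    have A: "A \<subseteq> X" using that by simp
    have "V.lin_indpt A" using that V.span_li_not_depend(2)[OF A sub] by simp
    then show ?thesis using V.li_le_dim[OF fin, of A] A XV by auto
  qed
  have "{} \<subseteq> carrier ?X \<and> X.lin_indpt {}" by (auto simp: X.lin_dep_def)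
  from maximal_exists[of "\<lambda>A. A \<subseteq> carrier ?X \<and> X.lin_indpt A", OF bound this]
  obtain A where A: "finite A" "maximal A (\<lambda>A. A \<subseteq> carrier ?X \<and> X.lin_indpt A)" by auto
  have basis: "X.basis A" using X.max_li_is_basis A(2) by blast
  then show "X.fin_dim" using A(1) by (auto simp: X.fin_dim_def X.basis_def)
  show "X.dim \<le> V.dim"
    using X.dim_basis[OF A(1) basis] bound[of A] A(2) by (simp add: maximal_def)
qed

lemma image_subspace:
  assumes V: "vectorspace K V" and W: "vectorspace K W" and T: "T \<in> module_hom K V W"
  shows "subspace K (T ` carrier V) W"
proof -
  interpret T: linear_map K V W T using linear_mapI[OF V W T] .
  show ?thesis using T.imT_is_subspace by (simp add: T.im_def)
qed

lemma image_finite_dimensional: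
  assumes V: "vectorspace K V" and W: "vectorspace K W" and T: "T \<in> module_hom K V W"
    and fin: "vectorspace.fin_dim K V"
  shows "vectorspace.fin_dim K (W\<lparr>carrier := T ` carrier V\<rparr>)"
    and "vectorspace.dim K (W\<lparr>carrier := T ` carrier V\<rparr>) \<le> vectorspace.dim K V"
proof -
  interpret T: linear_map K V W T using linear_mapI[OF V W T] .
  let ?I = "W\<lparr>carrier := T ` carrier V\<rparr>"
  have "vectorspace K ?I" using T.W.subspace_is_vs[OF image_subspace[OF V W T]] .
  moreover have "T \<in> module_hom K V ?I" using T by (auto simp: module_hom_def)
  ultimately interpret I: linear_map K V ?I T using linear_mapI[OF V] by blast
  show "vectorspace.fin_dim K ?I" using I.surj_fin_dim[OF fin] by simp
  show "vectorspace.dim K ?I \<le> T.V.dim" using T.rank_nullity[OF fin] by (simp add: T.im_def)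
qed

lemma nested_subspace:
  assumes "subspace K X V" "subspace K Y V" "X \<subseteq> Y"
  shows "subspace K X (V\<lparr>carrier := Y\<rparr>)"
proof -
  interpret V: vectorspace K V using assms(1) by (simp add: subspace_def)
  have "vectorspace K (V\<lparr>carrier := Y\<rparr>)" using V.subspace_is_vs assms(2) by blast
  with assms show ?thesis by (auto simp: subspace_def submodule_def vectorspace_def)
qed

text \<open>
  A map that factors through \<open>T\<close> has image inside \<open>\<beta>\<close> applied to the image of \<open>T\<close>, and linear maps do
  not raise dimension. The finiteness assumption matters because the dimension of an
  infinite-dimensional space is a junk value.
\<close>

lemma linear_rank_factor_le:
  assumes V: "vectorspace K V" and W: "vectorspace K W"
    and V': "vectorspace K V'" and W': "vectorspace K W'"
    and T: "T \<in> module_hom K V W" and T': "T' \<in> module_hom K V' W'"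
    and \<beta>: "\<beta> \<in> module_hom K W W'"
    and \<alpha>: "\<And>x. x \<in> carrier V' \<Longrightarrow> \<alpha> x \<in> carrier V"
    and factor: "\<And>x. x \<in> carrier V' \<Longrightarrow> T' x = \<beta> (T (\<alpha> x))"
    and fin: "vectorspace.fin_dim K (W\<lparr>carrier := T ` carrier V\<rparr>)"
  shows "linear_rank K V' W' T' \<le> linear_rank K V W T"
proof -
  let ?I = "W\<lparr>carrier := T ` carrier V\<rparr>"
  have subI: "subspace K (T ` carrier V) W" using image_subspace[OF V W T] .
  then have I: "vectorspace K ?I" using vectorspace.subspace_is_vs[OF W] by blast
  have \<beta>I: "\<beta> \<in> module_hom K ?I W'"
    using \<beta> subI by (simp add: module_hom_def subspace_def submodule_def subset_iff Pi_iff)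
  note image = image_finite_dimensional[OF I W' \<beta>I fin]
  let ?Y = "\<beta> ` carrier ?I"
  let ?J = "W'\<lparr>carrier := ?Y\<rparr>"
  have Y: "subspace K ?Y W'" by (rule image_subspace[OF I W' \<beta>I])
  have J: "vectorspace K ?J" using vectorspace.subspace_is_vs[OF W' Y] .
  have "T' ` carrier V' \<subseteq> ?Y" using factor \<alpha> by auto
  then have "subspace K (T' ` carrier V') ?J"
    using nested_subspace[OF image_subspace[OF V' W' T'] Y] by blast
  from subspace_finite_dimensional(2)[OF J image(1) this] image(2)
  show ?thesis by (simp add: linear_rank_def)
qed

section \<open>Quotient spaces and induced maps\<close>

lemma subspace_abelian_subgroup:
  assumes V: "vectorspace K V" and W: "subspace K W V"
  shows "abelian_subgroup W V"
proof -
  interpret V: vectorspace K V by fact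
  interpret W: submodule K W V using W by (simp add: subspace_def)
  have "subgroup W (add_monoid V)"
  proof
    fix x assume x: "x \<in> W"
    then have "x \<in> carrier V" using W.subset by auto
    then have "\<ominus>\<^bsub>V\<^esub> x = (\<ominus>\<^bsub>K\<^esub> \<one>\<^bsub>K\<^esub>) \<odot>\<^bsub>V\<^esub> x" using V.smult_minus_1 by simp
    moreover have "(\<ominus>\<^bsub>K\<^esub> \<one>\<^bsub>K\<^esub>) \<odot>\<^bsub>V\<^esub> x \<in> W" using x by simp
    ultimately show "inv\<^bsub>add_monoid V\<^esub> x \<in> W" by (simp add: a_inv_def)
  qed (use W.subset in auto)
  then show ?thesis
    by (intro abelian_subgroupI3 additive_subgroup.intro V.abelian_group_axioms)
qed

text \<open>
  The set on the left is both the way in which \<^const>\<open>quotient_space\<close> defines the scalar multiple of a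
  coset (for multiplication by a scalar as \<open>T\<close>) and a choice-free description of the map that \<open>T\<close>
  induces between quotients. So this single computation makes both well defined.
\<close>

lemma coset_image:
  assumes V: "vectorspace K V" and V': "vectorspace K V'"
    and W: "subspace K W V" and W': "subspace K W' V'"
    and T: "T \<in> module_hom K V V'" and TW: "T ` W \<subseteq> W'" and v: "v \<in> carrier V"
  shows "W' <+>\<^bsub>V'\<^esub> (T ` (W +>\<^bsub>V\<^esub> v)) = W' +>\<^bsub>V'\<^esub> T v"
proof -
  interpret V: vectorspace K V by fact
  interpret V': vectorspace K V' by fact
  interpret W: submodule K W V using W by (simp add: subspace_def)
  interpret W': submodule K W' V' using W' by (simp add: subspace_def)
  have Tv: "T v \<in> carrier V'" using T v by (auto simp: module_hom_def)
  have Tadd: "T (w \<oplus>\<^bsub>V\<^esub> v) = T w \<oplus>\<^bsub>V'\<^esub> T v" if "w \<in> W" for w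
    using module_hom_add[OF T] that v W.subset by blast
  show ?thesis
  proof (intro equalityI subsetI)
    fix y assume "y \<in> W' <+>\<^bsub>V'\<^esub> (T ` (W +>\<^bsub>V\<^esub> v))"
    then obtain u w where u: "u \<in> W'" and w: "w \<in> W" and y: "y = u \<oplus>\<^bsub>V'\<^esub> T (w \<oplus>\<^bsub>V\<^esub> v)"
      by (auto simp: set_add_def' a_r_coset_def')
    have Tw: "T w \<in> W'" using TW w by auto
    have "y = (u \<oplus>\<^bsub>V'\<^esub> T w) \<oplus>\<^bsub>V'\<^esub> T v"
      using y Tadd[OF w] u Tw Tv W'.subset by (simp add: V'.M.a_assoc subset_iff)
    then show "y \<in> W' +>\<^bsub>V'\<^esub> T v" using u Tw by (auto simp: a_r_coset_def')
  next
    fix y assume "y \<in> W' +>\<^bsub>V'\<^esub> T v"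
    then obtain u where u: "u \<in> W'" and y: "y = u \<oplus>\<^bsub>V'\<^esub> T v" by (auto simp: a_r_coset_def')
    moreover have "v \<in> W +>\<^bsub>V\<^esub> v"
      unfolding a_r_coset_def' using W.zero_closed V.M.l_zero[OF v, symmetric] by blast
    ultimately show "y \<in> W' <+>\<^bsub>V'\<^esub> (T ` (W +>\<^bsub>V\<^esub> v))" by (auto simp: set_add_def')
  qed
qed

lemma smult_module_hom:
  assumes V: "vectorspace K V" and c: "c \<in> carrier K"
  shows "(\<lambda>v. c \<odot>\<^bsub>V\<^esub> v) \<in> module_hom K V V"
proof -
  interpret V: vectorspace K V by fact
  show ?thesis using c
    by (auto simp: module_hom_def V.smult_r_distr V.smult_assoc1[symmetric] V.R.m_comm)
qed

context
  fixes K :: "('a, 'm) ring_scheme" and V :: "('a, 'b) module" and W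
  assumes V: "vectorspace K V" and W: "subspace K W V"
begin

lemma quotient_carrier: "carrier (quotient_space V W) = (\<lambda>v. W +>\<^bsub>V\<^esub> v) ` carrier V"
  by (auto simp: quotient_space_def A_RCOSETS_def')

lemma quotient_add:
  assumes "v \<in> carrier V" "w \<in> carrier V"
  shows "(W +>\<^bsub>V\<^esub> v) \<oplus>\<^bsub>quotient_space V W\<^esub> (W +>\<^bsub>V\<^esub> w) = W +>\<^bsub>V\<^esub> (v \<oplus>\<^bsub>V\<^esub> w)"
  using abelian_subgroup.a_rcos_sum[OF subspace_abelian_subgroup[OF V W] assms]
  by (simp add: quotient_space_def)

lemma quotient_smult:
  assumes "c \<in> carrier K" "v \<in> carrier V"
  shows "c \<odot>\<^bsub>quotient_space V W\<^esub> (W +>\<^bsub>V\<^esub> v) = W +>\<^bsub>V\<^esub> (c \<odot>\<^bsub>V\<^esub> v)"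
proof -
  have "(\<lambda>v. c \<odot>\<^bsub>V\<^esub> v) ` W \<subseteq> W" using W assms by (auto simp: subspace_def submodule_def)
  from coset_image[OF V V W W smult_module_hom[OF V assms(1)] this assms(2)]
  show ?thesis by (simp add: quotient_space_def)
qed

lemma quotient_zero: "\<zero>\<^bsub>quotient_space V W\<^esub> = W +>\<^bsub>V\<^esub> \<zero>\<^bsub>V\<^esub>"
proof -
  interpret V: vectorspace K V by (rule V)
  have "W \<subseteq> carrier V" using W by (auto simp: subspace_def submodule_def)
  then show ?thesis using V.M.a_coset_add_zero by (simp add: quotient_space_def)
qed

lemma vectorspace_quotient: "vectorspace K (quotient_space V W)"
proof -
  interpret V: vectorspace K V by (rule V)
  let ?Q = "quotient_space V W"
  note simps = quotient_add quotient_smult quotient_zero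
  have all: "(\<forall>X\<in>carrier ?Q. P X) \<longleftrightarrow> (\<forall>v\<in>carrier V. P (W +>\<^bsub>V\<^esub> v))" for P
    by (auto simp: quotient_carrier)
  have coset: "W +>\<^bsub>V\<^esub> v \<in> carrier ?Q" if "v \<in> carrier V" for v
    using that by (auto simp: quotient_carrier)
  have neg: "\<exists>u\<in>carrier ?Q. (W +>\<^bsub>V\<^esub> v) \<oplus>\<^bsub>?Q\<^esub> u = \<zero>\<^bsub>?Q\<^esub>" if v: "v \<in> carrier V" for v
  proof
    show "W +>\<^bsub>V\<^esub> (\<ominus>\<^bsub>V\<^esub> v) \<in> carrier ?Q" using v coset by simp
    show "(W +>\<^bsub>V\<^esub> v) \<oplus>\<^bsub>?Q\<^esub> (W +>\<^bsub>V\<^esub> (\<ominus>\<^bsub>V\<^esub> v)) = \<zero>\<^bsub>?Q\<^esub>"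
      using v by (simp add: simps V.M.r_neg)
  qed
  show ?thesis
  proof (rule vs_criteria)
    show "\<forall>X\<in>carrier ?Q. \<exists>Y\<in>carrier ?Q. X \<oplus>\<^bsub>?Q\<^esub> Y = \<zero>\<^bsub>?Q\<^esub>"
      using neg by (simp only: all) blast
    show "\<zero>\<^bsub>?Q\<^esub> \<in> carrier ?Q" by (simp add: quotient_zero coset)
    show "\<forall>X Y. X \<in> carrier ?Q \<and> Y \<in> carrier ?Q \<longrightarrow> X \<oplus>\<^bsub>?Q\<^esub> Y \<in> carrier ?Q"
      "\<forall>X Y. X \<in> carrier ?Q \<and> Y \<in> carrier ?Q \<longrightarrow> X \<oplus>\<^bsub>?Q\<^esub> Y = Y \<oplus>\<^bsub>?Q\<^esub> X"
      by (auto simp: quotient_carrier simps V.M.a_comm)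
    show "\<forall>X Y Z. X \<in> carrier ?Q \<and> Y \<in> carrier ?Q \<and> Z \<in> carrier ?Q \<longrightarrow>
        (X \<oplus>\<^bsub>?Q\<^esub> Y) \<oplus>\<^bsub>?Q\<^esub> Z = X \<oplus>\<^bsub>?Q\<^esub> (Y \<oplus>\<^bsub>?Q\<^esub> Z)"
      by (auto simp: quotient_carrier simps V.M.a_assoc)
    show "\<forall>X\<in>carrier ?Q. X \<oplus>\<^bsub>?Q\<^esub> \<zero>\<^bsub>?Q\<^esub> = X"
      "\<forall>X\<in>carrier ?Q. \<one>\<^bsub>K\<^esub> \<odot>\<^bsub>?Q\<^esub> X = X"
      by (auto simp: quotient_carrier simps)
    show "\<forall>c X. c \<in> carrier K \<and> X \<in> carrier ?Q \<longrightarrow> c \<odot>\<^bsub>?Q\<^esub> X \<in> carrier ?Q"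
      by (auto simp: quotient_carrier simps)
    show "\<forall>c e X. c \<in> carrier K \<and> e \<in> carrier K \<and> X \<in> carrier ?Q \<longrightarrow>
        (c \<otimes>\<^bsub>K\<^esub> e) \<odot>\<^bsub>?Q\<^esub> X = c \<odot>\<^bsub>?Q\<^esub> (e \<odot>\<^bsub>?Q\<^esub> X)"
      by (auto simp: quotient_carrier simps V.smult_assoc1)
    show "\<forall>c e X. c \<in> carrier K \<and> e \<in> carrier K \<and> X \<in> carrier ?Q \<longrightarrow>
        (c \<oplus>\<^bsub>K\<^esub> e) \<odot>\<^bsub>?Q\<^esub> X = c \<odot>\<^bsub>?Q\<^esub> X \<oplus>\<^bsub>?Q\<^esub> e \<odot>\<^bsub>?Q\<^esub> X"
      by (auto simp: quotient_carrier simps V.smult_l_distr)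
    show "\<forall>c X Y. c \<in> carrier K \<and> X \<in> carrier ?Q \<and> Y \<in> carrier ?Q \<longrightarrow>
        c \<odot>\<^bsub>?Q\<^esub> (X \<oplus>\<^bsub>?Q\<^esub> Y) = c \<odot>\<^bsub>?Q\<^esub> X \<oplus>\<^bsub>?Q\<^esub> c \<odot>\<^bsub>?Q\<^esub> Y"
      by (auto simp: quotient_carrier simps V.smult_r_distr)
  qed (rule V.field_axioms)
qed

lemma quotient_map_hom: "(\<lambda>v. W +>\<^bsub>V\<^esub> v) \<in> module_hom K V (quotient_space V W)"
  by (auto simp: module_hom_def quotient_carrier quotient_add quotient_smult)

end

lemma induced_quotient_map:
  assumes V: "vectorspace K V" and V': "vectorspace K V'"
    and W: "subspace K W V" and W': "subspace K W' V'"
    and T: "T \<in> module_hom K V V'" and TW: "T ` W \<subseteq> W'"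
  shows "(\<lambda>X. W' <+>\<^bsub>V'\<^esub> (T ` X)) \<in> module_hom K (quotient_space V W) (quotient_space V' W')"
proof -
  note simps = quotient_add[OF V W] quotient_add[OF V' W'] quotient_smult[OF V W]
    quotient_smult[OF V' W'] coset_image[OF V V' W W' T TW]
    quotient_carrier[OF V W] quotient_carrier[OF V' W']
  have closed: "T v \<in> carrier V'" if "v \<in> carrier V" for v
    using T that by (auto simp: module_hom_def)
  show ?thesis using T closed vectorspaceD[OF V]
    by (auto simp: module_hom_def simps abelian_monoid.a_closed module.smult_closed)
qed

section \<open>Spaces of families and direct sums\<close>

context
  fixes K :: "('a, 'm) ring_scheme" and V :: "'i \<Rightarrow> ('a, 'b) module" and S
  assumes V: "i \<in> S \<Longrightarrow> vectorspace K (V i)" and K: "field K"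
begin

text \<open>
  Inverses come from scalar multiplication: the negative of a family is its multiple by \<open>-1\<close>.
\<close>

lemma vectorspace_family_space:
  assumes sub: "C \<subseteq> (\<Pi>\<^sub>E i\<in>S. carrier (V i))"
    and zero: "(\<lambda>i\<in>S. \<zero>\<^bsub>V i\<^esub>) \<in> C"
    and add: "\<And>x y. x \<in> C \<Longrightarrow> y \<in> C \<Longrightarrow> (\<lambda>i\<in>S. x i \<oplus>\<^bsub>V i\<^esub> y i) \<in> C"
    and smult: "\<And>c x. c \<in> carrier K \<Longrightarrow> x \<in> C \<Longrightarrow> (\<lambda>i\<in>S. c \<odot>\<^bsub>V i\<^esub> x i) \<in> C"
  shows "vectorspace K (family_space S V C)"
proof -
  note mod = vectorspaceD(1)[OF V] and grp = vectorspaceD(2)[OF V] and mon = vectorspaceD(3)[OF V]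
  have el: "x i \<in> carrier (V i)" if "x \<in> C" "i \<in> S" for x i
    using sub that by auto
  have ext: "restrict x S = x" if "x \<in> C" for x
    using sub that by (auto simp: PiE_def extensional_restrict)
  have cring: "cring K" using K by (simp add: field_def domain_def)
  note minus_one = abelian_group.a_inv_closed[OF ring.is_abelian_group[OF cring.axioms(1)[OF cring]]
      monoid.one_closed[OF ring.is_monoid[OF cring.axioms(1)[OF cring]]]]
  let ?F = "family_space S V C"
  show ?thesis
  proof (rule vs_criteria)
    show "\<forall>x\<in>carrier ?F. \<exists>y\<in>carrier ?F. x \<oplus>\<^bsub>?F\<^esub> y = \<zero>\<^bsub>?F\<^esub>"
    proof
      fix x assume "x \<in> carrier ?F"
      then have x: "x \<in> C" by (simp add: family_space_def)
      let ?y = "\<lambda>i\<in>S. (\<ominus>\<^bsub>K\<^esub> \<one>\<^bsub>K\<^esub>) \<odot>\<^bsub>V i\<^esub> x i"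
      have "x i \<oplus>\<^bsub>V i\<^esub> ((\<ominus>\<^bsub>K\<^esub> \<one>\<^bsub>K\<^esub>) \<odot>\<^bsub>V i\<^esub> x i) = \<zero>\<^bsub>V i\<^esub>" if "i \<in> S" for i
        using module.smult_minus_1[OF mod[OF that] el[OF x that]]
          abelian_group.r_neg[OF grp[OF that] el[OF x that]] by simp
      then have "x \<oplus>\<^bsub>?F\<^esub> ?y = \<zero>\<^bsub>?F\<^esub>"
        by (auto simp: family_space_def intro!: restrict_ext)
      moreover have "?y \<in> carrier ?F"
        using smult[OF minus_one x] by (simp add: family_space_def)
      ultimately show "\<exists>y\<in>carrier ?F. x \<oplus>\<^bsub>?F\<^esub> y = \<zero>\<^bsub>?F\<^esub>" by blast
    qed
    show "\<zero>\<^bsub>?F\<^esub> \<in> carrier ?F" using zero by (simp add: family_space_def)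
    show "\<forall>x y. x \<in> carrier ?F \<and> y \<in> carrier ?F \<longrightarrow> x \<oplus>\<^bsub>?F\<^esub> y \<in> carrier ?F"
      using add by (simp add: family_space_def)
    show "\<forall>x y. x \<in> carrier ?F \<and> y \<in> carrier ?F \<longrightarrow> x \<oplus>\<^bsub>?F\<^esub> y = y \<oplus>\<^bsub>?F\<^esub> x"
      by (auto simp: family_space_def el abelian_monoid.a_comm[OF mon] intro!: restrict_ext)
    show "\<forall>x y z. x \<in> carrier ?F \<and> y \<in> carrier ?F \<and> z \<in> carrier ?F \<longrightarrow>
        (x \<oplus>\<^bsub>?F\<^esub> y) \<oplus>\<^bsub>?F\<^esub> z = x \<oplus>\<^bsub>?F\<^esub> (y \<oplus>\<^bsub>?F\<^esub> z)"
      by (auto simp: family_space_def el abelian_monoid.a_assoc[OF mon] intro!: restrict_ext)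
    show "\<forall>x\<in>carrier ?F. x \<oplus>\<^bsub>?F\<^esub> \<zero>\<^bsub>?F\<^esub> = x"
      "\<forall>x\<in>carrier ?F. \<one>\<^bsub>K\<^esub> \<odot>\<^bsub>?F\<^esub> x = x"
      by (auto simp: family_space_def el abelian_monoid.r_zero[OF mon] module.smult_one[OF mod] ext
          cong: restrict_cong)
    show "\<forall>c x. c \<in> carrier K \<and> x \<in> carrier ?F \<longrightarrow> c \<odot>\<^bsub>?F\<^esub> x \<in> carrier ?F"
      using smult by (simp add: family_space_def)
    show "\<forall>c e x. c \<in> carrier K \<and> e \<in> carrier K \<and> x \<in> carrier ?F \<longrightarrow>
        (c \<otimes>\<^bsub>K\<^esub> e) \<odot>\<^bsub>?F\<^esub> x = c \<odot>\<^bsub>?F\<^esub> (e \<odot>\<^bsub>?F\<^esub> x)"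
      by (auto simp: family_space_def el module.smult_assoc1[OF mod] intro!: restrict_ext)
    show "\<forall>c e x. c \<in> carrier K \<and> e \<in> carrier K \<and> x \<in> carrier ?F \<longrightarrow>
        (c \<oplus>\<^bsub>K\<^esub> e) \<odot>\<^bsub>?F\<^esub> x = c \<odot>\<^bsub>?F\<^esub> x \<oplus>\<^bsub>?F\<^esub> e \<odot>\<^bsub>?F\<^esub> x"
      by (auto simp: family_space_def el module.smult_l_distr[OF mod] intro!: restrict_ext)
    show "\<forall>c x y. c \<in> carrier K \<and> x \<in> carrier ?F \<and> y \<in> carrier ?F \<longrightarrow>
        c \<odot>\<^bsub>?F\<^esub> (x \<oplus>\<^bsub>?F\<^esub> y) = c \<odot>\<^bsub>?F\<^esub> x \<oplus>\<^bsub>?F\<^esub> c \<odot>\<^bsub>?F\<^esub> y"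
      by (auto simp: family_space_def el module.smult_r_distr[OF mod] intro!: restrict_ext)
  qed (rule K)
qed

lemma family_projection_hom:
  assumes "C \<subseteq> (\<Pi>\<^sub>E i\<in>S. carrier (V i))" "i \<in> S"
  shows "(\<lambda>x. x i) \<in> module_hom K (family_space S V C) (V i)"
  using assms by (auto simp: module_hom_def family_space_def)

lemma vectorspace_direct_sum: "vectorspace K (direct_sum_space S V)"
  unfolding direct_sum_space_def
proof (rule vectorspace_family_space)
  note mod = vectorspaceD(1)[OF V] and mon = vectorspaceD(3)[OF V]
  let ?C = "{x \<in> (\<Pi>\<^sub>E i\<in>S. carrier (V i)). finite {i \<in> S. x i \<noteq> \<zero>\<^bsub>V i\<^esub>}}"
  show "?C \<subseteq> (\<Pi>\<^sub>E i\<in>S. carrier (V i))" by auto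
  show "(\<lambda>i\<in>S. \<zero>\<^bsub>V i\<^esub>) \<in> ?C"
    by (auto simp: abelian_monoid.zero_closed[OF mon] cong: conj_cong)
  fix x assume x: "x \<in> ?C"
  {
    fix y assume y: "y \<in> ?C"
    have "{i \<in> S. (\<lambda>i\<in>S. x i \<oplus>\<^bsub>V i\<^esub> y i) i \<noteq> \<zero>\<^bsub>V i\<^esub>}
        \<subseteq> {i \<in> S. x i \<noteq> \<zero>\<^bsub>V i\<^esub>} \<union> {i \<in> S. y i \<noteq> \<zero>\<^bsub>V i\<^esub>}"
      by (auto simp: abelian_monoid.l_zero[OF mon] abelian_monoid.zero_closed[OF mon])
    then have "finite {i \<in> S. (\<lambda>i\<in>S. x i \<oplus>\<^bsub>V i\<^esub> y i) i \<noteq> \<zero>\<^bsub>V i\<^esub>}"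
      by (rule finite_subset) (use x y in auto)
    then show "(\<lambda>i\<in>S. x i \<oplus>\<^bsub>V i\<^esub> y i) \<in> ?C"
      using x y by (auto intro!: abelian_monoid.a_closed[OF mon])
  }
  {
    fix c assume c: "c \<in> carrier K"
    have "{i \<in> S. (\<lambda>i\<in>S. c \<odot>\<^bsub>V i\<^esub> x i) i \<noteq> \<zero>\<^bsub>V i\<^esub>} \<subseteq> {i \<in> S. x i \<noteq> \<zero>\<^bsub>V i\<^esub>}"
      by (auto simp: module.rmult_0[OF mod c])
    then have "finite {i \<in> S. (\<lambda>i\<in>S. c \<odot>\<^bsub>V i\<^esub> x i) i \<noteq> \<zero>\<^bsub>V i\<^esub>}"
      by (rule finite_subset) (use x in auto)
    then show "(\<lambda>i\<in>S. c \<odot>\<^bsub>V i\<^esub> x i) \<in> ?C"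
      using x c by (auto intro!: module.smult_closed[OF mod])
  }
qed

lemma inclusion_hom:
  assumes i: "i \<in> S"
  shows "inclusion S V i \<in> module_hom K (V i) (direct_sum_space S V)"
proof -
  note mod = vectorspaceD(1)[OF V] and mon = vectorspaceD(3)[OF V]
  have fin: "finite {j \<in> S. inclusion S V i v j \<noteq> \<zero>\<^bsub>V j\<^esub>}" for v
    by (rule finite_subset[of _ "{i}"]) (auto simp: inclusion_def)
  then show ?thesis
    using i
    by (auto simp: module_hom_def direct_sum_space_def family_space_def abelian_monoid.zero_closed[OF mon] fin)
       (auto simp: inclusion_def abelian_monoid.zero_closed[OF mon] abelian_monoid.l_zero[OF mon]
          module.rmult_0[OF mod] intro!: restrict_ext split: if_splits)
qed

end

text \<open>
  \<open>relabel\<close> is the map of direct sums that sends the summand at \<open>p\<close> to the summand at \<open>t p\<close> by \<open>f p\<close>.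
  Since \<open>t\<close> is injective wherever it is used, every coordinate of the value depends on at most one
  coordinate of the argument, and the map can be given coordinatewise without finite sums.
\<close>

definition relabel ::
    "'i set \<Rightarrow> ('j \<Rightarrow> ('a, 'c) module) \<Rightarrow> 'j set \<Rightarrow> ('i \<Rightarrow> 'j) \<Rightarrow> ('i \<Rightarrow> 'b \<Rightarrow> 'c)
      \<Rightarrow> ('i \<Rightarrow> 'b) \<Rightarrow> ('j \<Rightarrow> 'c)" where
  "relabel A W B t f x =
     (\<lambda>q\<in>B. if q \<in> t ` A then f (inv_into A t q) (x (inv_into A t q)) else \<zero>\<^bsub>W q\<^esub>)"

context
  fixes K :: "('a, 'm) ring_scheme" and V :: "'i \<Rightarrow> ('a, 'b) module"
    and W :: "'j \<Rightarrow> ('a, 'c) module" and A B t f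
  assumes V: "p \<in> A \<Longrightarrow> vectorspace K (V p)" and W: "q \<in> B \<Longrightarrow> vectorspace K (W q)"
    and K: "field K"
    and t: "inj_on t A" "t ` A \<subseteq> B"
    and f: "p \<in> A \<Longrightarrow> f p \<in> module_hom K (V p) (W (t p))"
begin

lemma hom_zero: "p \<in> A \<Longrightarrow> f p \<zero>\<^bsub>V p\<^esub> = \<zero>\<^bsub>W (t p)\<^esub>"
proof -
  assume p: "p \<in> A"
  interpret linear_map K "V p" "W (t p)" "f p"
    using linear_mapI V[OF p] W[of "t p"] f[OF p] p t(2) by blast
  show ?thesis by (rule f0_is_0)
qed

lemma relabel_hom:
  "relabel A W B t f \<in> module_hom K (direct_sum_space A V) (direct_sum_space B W)"
proof -
  note mod = vectorspaceD(1)[OF W] and mon = vectorspaceD(3)[OF W]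
  have support: "finite {q \<in> B. relabel A W B t f x q \<noteq> \<zero>\<^bsub>W q\<^esub>}"
    if "finite {p \<in> A. x p \<noteq> \<zero>\<^bsub>V p\<^esub>}" for x
    by (rule finite_subset[of _ "t ` {p \<in> A. x p \<noteq> \<zero>\<^bsub>V p\<^esub>}"])
      (use that t hom_zero in \<open>auto simp: relabel_def split: if_splits\<close>)
  have closed: "relabel A W B t f x \<in> (\<Pi>\<^sub>E q\<in>B. carrier (W q))" if "x \<in> (\<Pi>\<^sub>E p\<in>A. carrier (V p))" for x
    using that t f by (fastforce simp: relabel_def abelian_monoid.zero_closed[OF mon] module_hom_def)
  have add: "relabel A W B t f (\<lambda>i\<in>A. x i \<oplus>\<^bsub>V i\<^esub> y i)
      = (\<lambda>q\<in>B. relabel A W B t f x q \<oplus>\<^bsub>W q\<^esub> relabel A W B t f y q)"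
    if "x \<in> (\<Pi>\<^sub>E p\<in>A. carrier (V p))" "y \<in> (\<Pi>\<^sub>E p\<in>A. carrier (V p))" for x y
    using t module_hom_add[OF f] PiE_mem[OF that(1)] PiE_mem[OF that(2)]
    by (auto simp: relabel_def abelian_monoid.zero_closed[OF mon]
        abelian_monoid.l_zero[OF mon] intro!: restrict_ext)
  have smult: "relabel A W B t f (\<lambda>i\<in>A. c \<odot>\<^bsub>V i\<^esub> x i) = (\<lambda>q\<in>B. c \<odot>\<^bsub>W q\<^esub> relabel A W B t f x q)"
    if "c \<in> carrier K" "x \<in> (\<Pi>\<^sub>E p\<in>A. carrier (V p))" for c x
    using that(1) t module_hom_smult[OF f] PiE_mem[OF that(2)]
    by (auto simp: relabel_def module.rmult_0[OF mod] intro!: restrict_ext)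
  show ?thesis
    using support closed add smult
    by (simp add: module_hom_def direct_sum_space_def family_space_def)
qed

lemma relabel_inclusion:
  assumes "p \<in> A"
  shows "relabel A W B t f (inclusion A V p x) = inclusion B W (t p) (f p x)"
  using assms t hom_zero
  by (auto simp: relabel_def inclusion_def inj_on_eq_iff intro!: restrict_ext)

end

section \<open>Limits and colimits of persistence modules\<close>

definition colimit_map ::
    "('a, 'm) ring_scheme \<Rightarrow> ('p::order, 'a, 'b) pers \<Rightarrow> 'p set \<Rightarrow> 'p \<Rightarrow> 'b \<Rightarrow> ('p \<Rightarrow> 'b) set" where
  "colimit_map K M S p x =
     colimit_relations K M S +>\<^bsub>direct_sum_space S (obj M)\<^esub> inclusion S (obj M) p x"

context persistence_module
begin

lemma vectorspace_limit: "vectorspace K (limit_space M S)"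
  unfolding limit_space_def
proof (rule vectorspace_family_space[OF vs field])
  let ?C = "{x \<in> (\<Pi>\<^sub>E p\<in>S. carrier (obj M p)).
      \<forall>p\<in>S. \<forall>q\<in>S. p \<le> q \<longrightarrow> mor M p q (x p) = x q}"
  note mod = vectorspaceD(1)[OF vs] and mon = vectorspaceD(3)[OF vs]
  have mor_zero: "mor M p q \<zero>\<^bsub>obj M p\<^esub> = \<zero>\<^bsub>obj M q\<^esub>" if "p \<le> q" for p q
    using mod_hom.f0_is_0[of K "obj M p" "obj M q" "mor M p q"] mod hom[OF that]
    by (simp add: mod_hom_def mod_hom_axioms_def)
  show "?C \<subseteq> (\<Pi>\<^sub>E p\<in>S. carrier (obj M p))" by auto
  show "(\<lambda>p\<in>S. \<zero>\<^bsub>obj M p\<^esub>) \<in> ?C"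
    using mor_zero by (auto simp: abelian_monoid.zero_closed[OF mon])
  have el: "x p \<in> carrier (obj M p)" if "x \<in> ?C" "p \<in> S" for x p
    using that by auto
  fix x assume x: "x \<in> ?C"
  show "(\<lambda>p\<in>S. x p \<oplus>\<^bsub>obj M p\<^esub> y p) \<in> ?C" if y: "y \<in> ?C" for y
    using x y module_hom_add[OF hom] el[OF x] el[OF y]
    by (auto intro!: abelian_monoid.a_closed[OF mon])
  show "(\<lambda>p\<in>S. c \<odot>\<^bsub>obj M p\<^esub> x p) \<in> ?C" if c: "c \<in> carrier K" for c
    using x c module_hom_smult[OF hom] el[OF x]
    by (auto intro!: module.smult_closed[OF mod])
qed

lemma limit_projection_hom:
  "p \<in> S \<Longrightarrow> (\<lambda>x. x p) \<in> module_hom K (limit_space M S) (obj M p)"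
  unfolding limit_space_def by (rule family_projection_hom[OF vs field]) auto

lemma vectorspace_sum: "vectorspace K (direct_sum_space S (obj M))"
  by (rule vectorspace_direct_sum[OF vs field])

lemma inclusion_obj_hom:
  "p \<in> S \<Longrightarrow> inclusion S (obj M) p \<in> module_hom K (obj M p) (direct_sum_space S (obj M))"
  by (rule inclusion_hom[OF vs field])

lemma limit_to_colimit_eq: "limit_to_colimit K M S x = colimit_map K M S (SOME p. p \<in> S) (x (SOME p. p \<in> S))"
  by (simp add: limit_to_colimit_def colimit_map_def Let_def)

lemma relation_closed:
  assumes "p \<in> S" "q \<in> S" "p \<le> q" "x \<in> carrier (obj M p)"
  shows "inclusion S (obj M) p x \<in> carrier (direct_sum_space S (obj M))"
    and "inclusion S (obj M) q (mor M p q x) \<in> carrier (direct_sum_space S (obj M))"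
    and "inclusion S (obj M) p x \<ominus>\<^bsub>direct_sum_space S (obj M)\<^esub> inclusion S (obj M) q (mor M p q x)
           \<in> carrier (direct_sum_space S (obj M))"
proof -
  interpret D: vectorspace K "direct_sum_space S (obj M)" by (rule vectorspace_sum)
  have "mor M p q x \<in> carrier (obj M q)"
    using module_hom_closed[OF hom[OF assms(3)]] assms(4) by auto
  then show "inclusion S (obj M) p x \<in> carrier (direct_sum_space S (obj M))"
    and "inclusion S (obj M) q (mor M p q x) \<in> carrier (direct_sum_space S (obj M))"
    using module_hom_closed[OF inclusion_obj_hom] assms by blast+
  then show "inclusion S (obj M) p x \<ominus>\<^bsub>direct_sum_space S (obj M)\<^esub> inclusion S (obj M) q (mor M p q x)
           \<in> carrier (direct_sum_space S (obj M))"
    by (rule D.M.minus_closed)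
qed

lemma subspace_relations: "subspace K (colimit_relations K M S) (direct_sum_space S (obj M))"
proof -
  interpret D: vectorspace K "direct_sum_space S (obj M)" by (rule vectorspace_sum)
  show ?thesis
    unfolding colimit_relations_def
    by (rule D.span_is_subspace) (use relation_closed(3) in blast)
qed

lemma vectorspace_colimit: "vectorspace K (colimit_space K M S)"
  unfolding colimit_space_def by (rule vectorspace_quotient[OF vectorspace_sum subspace_relations])

lemma colimit_map_hom:
  assumes "p \<in> S"
  shows "colimit_map K M S p \<in> module_hom K (obj M p) (colimit_space K M S)"
proof -
  have "(\<lambda>x. colimit_map K M S p x) \<in> module_hom K (obj M p) (colimit_space K M S)"
    unfolding colimit_space_def colimit_map_def
    by (rule module_hom_comp[OF inclusion_obj_hom[OF assms]
        quotient_map_hom[OF vectorspace_sum subspace_relations]])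
  then show ?thesis by simp
qed

lemma colimit_map_mor:
  assumes "p \<in> S" "q \<in> S" "p \<le> q" "x \<in> carrier (obj M p)"
  shows "colimit_map K M S q (mor M p q x) = colimit_map K M S p x"
proof -
  let ?D = "direct_sum_space S (obj M)"
  let ?R = "colimit_relations K M S"
  interpret D: vectorspace K ?D by (rule vectorspace_sum)
  interpret R: abelian_subgroup ?R ?D
    by (rule subspace_abelian_subgroup[OF vectorspace_sum subspace_relations])
  note closed = relation_closed[OF assms]
  have "inclusion S (obj M) p x \<ominus>\<^bsub>?D\<^esub> inclusion S (obj M) q (mor M p q x) \<in> ?R"
    unfolding colimit_relations_def
    by (rule subsetD[OF D.in_own_span]) (use assms relation_closed(3) in blast)+
  then have "inclusion S (obj M) p x \<in> ?R +>\<^bsub>?D\<^esub> inclusion S (obj M) q (mor M p q x)"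
    using R.a_rcos_module[OF closed(2,1)] D.abelian_group_axioms by (simp add: a_minus_def)
  then show ?thesis
    using R.a_repr_independence' closed by (simp add: colimit_map_def)
qed

text \<open>
  The elements of a compatible family at comparable points are related by an internal map, so they are
  identified in the colimit; a chain of comparabilities carries this over to any two points. Hence the
  canonical map does not depend on the point at which it is evaluated.
\<close>

lemma colimit_map_limit_eq:
  assumes S: "poset_connected S" and x: "x \<in> carrier (limit_space M S)" and "p \<in> S" "q \<in> S"
  shows "colimit_map K M S p (x p) = colimit_map K M S q (x q)"
proof -
  have el: "x p \<in> carrier (obj M p)" if "p \<in> S" for p
    using x that by (auto simp: limit_space_def family_space_def)
  have step: "colimit_map K M S p (x p) = colimit_map K M S q (x q)" if "p \<in> S" "q \<in> S" "p \<le> q" for p q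
  proof -
    have "x q = mor M p q (x p)"
      using x that by (simp add: limit_space_def family_space_def)
    then show ?thesis using colimit_map_mor[OF that el] that by simp
  qed
  have "(\<lambda>x y. x \<in> S \<and> y \<in> S \<and> (x \<le> y \<or> y \<le> x))\<^sup>*\<^sup>* p q"
    using S assms by (simp add: poset_connected_def)
  then show ?thesis
    by (induction rule: rtranclp_induct) (use step in metis)+
qed

lemma limit_to_colimit_hom:
  assumes "S \<noteq> {}"
  shows "limit_to_colimit K M S \<in> module_hom K (limit_space M S) (colimit_space K M S)"
proof -
  have "(SOME p. p \<in> S) \<in> S" using assms by (simp add: some_in_eq)
  from module_hom_comp[OF limit_projection_hom[OF this] colimit_map_hom[OF this]]
  have "(\<lambda>x. limit_to_colimit K M S x) \<in> module_hom K (limit_space M S) (colimit_space K M S)"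
    by (simp only: limit_to_colimit_eq)
  then show ?thesis by simp
qed

text \<open>
  The limit and the colimit may well be infinite-dimensional, but the canonical map between them passes
  through the value of the module at one point.
\<close>

lemma image_limit_to_colimit_fin_dim:
  assumes "S \<noteq> {}"
  shows "vectorspace.fin_dim K
    ((colimit_space K M S)\<lparr>carrier := limit_to_colimit K M S ` carrier (limit_space M S)\<rparr>)"
proof -
  define p where "p = (SOME p. p \<in> S)"
  have p: "p \<in> S" using assms by (simp add: p_def some_in_eq)
  let ?C = "colimit_space K M S"
  let ?J = "colimit_map K M S p ` carrier (obj M p)"
  have J: "subspace K ?J ?C"
    by (rule image_subspace[OF vs vectorspace_colimit colimit_map_hom[OF p]])
  have fin: "vectorspace.fin_dim K (?C\<lparr>carrier := ?J\<rparr>)"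
    by (rule image_finite_dimensional(1)[OF vs vectorspace_colimit colimit_map_hom[OF p] fin_dim])
  have "limit_to_colimit K M S ` carrier (limit_space M S) \<subseteq> ?J"
    using p by (auto simp: limit_to_colimit_eq p_def limit_space_def family_space_def)
  with image_subspace[OF vectorspace_limit vectorspace_colimit limit_to_colimit_hom[OF assms]] J
  have "subspace K (limit_to_colimit K M S ` carrier (limit_space M S)) (?C\<lparr>carrier := ?J\<rparr>)"
    by (intro nested_subspace)
  moreover have "vectorspace K (?C\<lparr>carrier := ?J\<rparr>)"
    using vectorspace.subspace_is_vs[OF vectorspace_colimit J] .
  ultimately show ?thesis
    using subspace_finite_dimensional(1)[OF _ fin] by simp
qed

end

section \<open>Factorization through another persistence module\<close>

text \<open>
  Naturality sends each generating relation of the first colimit to a generating relation of the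
  second, so a natural family of maps descends to the colimits.
\<close>

lemma relabel_relations:
  fixes M :: "('p::order, 'a, 'b) pers" and N :: "('q::order, 'a, 'c) pers"
  assumes M: "persistence_module K M" and N: "persistence_module K N"
    and t: "inj_on t A" "t ` A \<subseteq> B" "\<And>p q. p \<in> A \<Longrightarrow> q \<in> A \<Longrightarrow> p \<le> q \<Longrightarrow> t p \<le> t q"
    and f: "\<And>p. p \<in> A \<Longrightarrow> f p \<in> module_hom K (obj M p) (obj N (t p))"
    and natural: "\<And>p q x. p \<in> A \<Longrightarrow> q \<in> A \<Longrightarrow> p \<le> q \<Longrightarrow> x \<in> carrier (obj M p) \<Longrightarrow>
      f q (mor M p q x) = mor N (t p) (t q) (f p x)"
  shows "relabel A (obj N) B t f ` colimit_relations K M A \<subseteq> colimit_relations K N B"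
proof -
  interpret M: persistence_module K M by fact
  interpret N: persistence_module K N by fact
  let ?D = "direct_sum_space A (obj M)" and ?E = "direct_sum_space B (obj N)"
  let ?F = "relabel A (obj N) B t f"
  have hom: "?F \<in> module_hom K ?D ?E"
    by (rule relabel_hom[where f = f, OF M.vs N.vs M.field t(1,2) f])
  interpret D: vectorspace K ?D by (rule M.vectorspace_sum)
  interpret E: vectorspace K ?E by (rule N.vectorspace_sum)
  interpret F: linear_map K ?D ?E ?F
    by (rule linear_mapI[OF M.vectorspace_sum N.vectorspace_sum hom])
  interpret R: submodule K "colimit_relations K N B" ?E
    using N.subspace_relations[of B] by (simp add: subspace_def)
  note incl = relabel_inclusion[where f = f, OF M.vs N.vs M.field t(1,2) f]
  \<comment> \<open>the preimage of the relations is a subspace, so it suffices to test generators\<close>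
  let ?P = "{x \<in> carrier ?D. ?F x \<in> colimit_relations K N B}"
  have "submodule K ?P ?D"
    by (rule submodule.intro) (use M.vectorspace_sum in \<open>auto simp: vectorspace_def\<close>)
  moreover have "{inclusion A (obj M) p x \<ominus>\<^bsub>?D\<^esub> inclusion A (obj M) q (mor M p q x)
      | p q x. p \<in> A \<and> q \<in> A \<and> p \<le> q \<and> x \<in> carrier (obj M p)} \<subseteq> ?P"
  proof clarify
    fix p q x assume pq: "p \<in> A" "q \<in> A" "p \<le> q" and x: "x \<in> carrier (obj M p)"
    note closed = M.relation_closed[OF pq x]
    have tpq: "t p \<in> B" "t q \<in> B" "t p \<le> t q" using t pq by auto
    have fx: "f p x \<in> carrier (obj N (t p))" using module_hom_closed[OF f[OF pq(1)]] x by auto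
    have "?F (inclusion A (obj M) p x \<ominus>\<^bsub>?D\<^esub> inclusion A (obj M) q (mor M p q x))
      = inclusion B (obj N) (t p) (f p x) \<ominus>\<^bsub>?E\<^esub> inclusion B (obj N) (t q) (mor N (t p) (t q) (f p x))"
      using F.f_minus[OF closed(1,2)] incl pq natural[OF pq x] by simp
    also have "\<dots> \<in> colimit_relations K N B"
      unfolding colimit_relations_def
      by (rule subsetD[OF E.in_own_span]) (use N.relation_closed(3) tpq fx in blast)+
    finally show "inclusion A (obj M) p x \<ominus>\<^bsub>?D\<^esub> inclusion A (obj M) q (mor M p q x) \<in> carrier ?D \<and>
      ?F (inclusion A (obj M) p x \<ominus>\<^bsub>?D\<^esub> inclusion A (obj M) q (mor M p q x)) \<in> colimit_relations K N B"
      using closed(3) by blast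
  qed
  ultimately have "colimit_relations K M A \<subseteq> ?P"
    unfolding colimit_relations_def by (intro D.span_is_subset)
  then show ?thesis by auto
qed

text \<open>
  Along \<open>s\<close>, the maps \<open>g\<close> turn compatible families of \<open>N\<close> over \<open>B\<close> into compatible families of \<open>M\<close>
  over \<open>A\<close>; along \<open>t\<close>, the maps \<open>f\<close> induce a map from the colimit of \<open>M\<close> over \<open>A\<close> to that of \<open>N\<close> over
  \<open>B\<close>. Following the canonical map of \<open>M\<close> between these two, a family \<open>x\<close> goes to the class of
  \<open>f p (g p (x (s p)))\<close>, which is \<open>x (s p)\<close> moved to \<open>t p\<close>, hence \<open>x (t p)\<close>. Since \<open>B\<close> is connected,
  this class is the value of the canonical map of \<open>N\<close> at \<open>x\<close>, so that map factors through the
  canonical map of \<open>M\<close>.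
\<close>

lemma gen_rank_le_of_factorization:
  fixes M :: "('p::order, 'a, 'b) pers" and N :: "('q::order, 'a, 'c) pers"
  assumes M: "persistence_module K M" and N: "persistence_module K N"
    and A: "A \<noteq> {}" and B: "poset_connected B"
    and s: "s ` A \<subseteq> B" "\<And>p q. p \<in> A \<Longrightarrow> q \<in> A \<Longrightarrow> p \<le> q \<Longrightarrow> s p \<le> s q"
    and t: "inj_on t A" "t ` A \<subseteq> B" "\<And>p q. p \<in> A \<Longrightarrow> q \<in> A \<Longrightarrow> p \<le> q \<Longrightarrow> t p \<le> t q"
    and st: "\<And>p. p \<in> A \<Longrightarrow> s p \<le> t p"
    and g: "\<And>p. p \<in> A \<Longrightarrow> g p \<in> module_hom K (obj N (s p)) (obj M p)"
    and g_natural: "\<And>p q y. p \<in> A \<Longrightarrow> q \<in> A \<Longrightarrow> p \<le> q \<Longrightarrow> y \<in> carrier (obj N (s p)) \<Longrightarrow>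
      g q (mor N (s p) (s q) y) = mor M p q (g p y)"
    and f: "\<And>p. p \<in> A \<Longrightarrow> f p \<in> module_hom K (obj M p) (obj N (t p))"
    and f_natural: "\<And>p q x. p \<in> A \<Longrightarrow> q \<in> A \<Longrightarrow> p \<le> q \<Longrightarrow> x \<in> carrier (obj M p) \<Longrightarrow>
      f q (mor M p q x) = mor N (t p) (t q) (f p x)"
    and fg: "\<And>p y. p \<in> A \<Longrightarrow> y \<in> carrier (obj N (s p)) \<Longrightarrow> f p (g p y) = mor N (s p) (t p) y"
  shows "gen_rank K N B \<le> gen_rank K M A"
proof -
  interpret M: persistence_module K M by fact
  interpret N: persistence_module K N by fact
  have B_ne: "B \<noteq> {}" using A s(1) by auto
  let ?D = "direct_sum_space A (obj M)" and ?E = "direct_sum_space B (obj N)"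
  let ?R = "colimit_relations K M A" and ?S = "colimit_relations K N B"
  let ?F = "relabel A (obj N) B t f"
  define \<alpha> where "\<alpha> x = (\<lambda>p\<in>A. g p (x (s p)))" for x
  define \<beta> where "\<beta> X = ?S <+>\<^bsub>?E\<^esub> (?F ` X)" for X
  \<comment> \<open>the point at which the canonical map of \<open>M\<close> is evaluated by definition\<close>
  define p where "p = (SOME p. p \<in> A)"
  have p: "p \<in> A" using A by (simp add: p_def some_in_eq)
  have F_hom: "?F \<in> module_hom K ?D ?E"
    by (rule relabel_hom[where f = f, OF M.vs N.vs M.field t(1,2) f])
  have F_rel: "?F ` ?R \<subseteq> ?S"
    by (rule relabel_relations[OF M N t f f_natural])
  have \<beta>_hom: "\<beta> \<in> module_hom K (colimit_space K M A) (colimit_space K N B)"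
    using induced_quotient_map[OF M.vectorspace_sum N.vectorspace_sum M.subspace_relations
        N.subspace_relations F_hom F_rel]
    by (simp add: colimit_space_def \<beta>_def[abs_def])
  have \<beta>_colimit_map: "\<beta> (colimit_map K M A p y) = colimit_map K N B (t p) (f p y)"
    if "y \<in> carrier (obj M p)" for y
  proof -
    have "inclusion A (obj M) p y \<in> carrier ?D"
      using module_hom_closed[OF M.inclusion_obj_hom[OF p]] that by auto
    from coset_image[OF M.vectorspace_sum N.vectorspace_sum M.subspace_relations
        N.subspace_relations F_hom F_rel this]
    show ?thesis
      using relabel_inclusion[where f = f, OF M.vs N.vs M.field t(1,2) f p]
      by (simp add: \<beta>_def colimit_map_def)
  qed
  have el: "x q \<in> carrier (obj N q)" if "x \<in> carrier (limit_space N B)" "q \<in> B" for x q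
    using that by (auto simp: limit_space_def family_space_def)
  have mor: "mor N q r (x q) = x r"
    if "x \<in> carrier (limit_space N B)" "q \<in> B" "r \<in> B" "q \<le> r" for x q r
    using that by (auto simp: limit_space_def family_space_def)
  have sB: "s p \<in> B" and tB: "t p \<in> B" if "p \<in> A" for p
    using s(1) t(2) that by auto
  have gx: "g p (x (s p)) \<in> carrier (obj M p)"
    if "x \<in> carrier (limit_space N B)" "p \<in> A" for x p
    using module_hom_closed[OF g[OF that(2)]] el[OF that(1) sB[OF that(2)]] by auto
  have \<alpha>: "\<alpha> x \<in> carrier (limit_space M A)" if x: "x \<in> carrier (limit_space N B)" for x
  proof -
    have "mor M p q (g p (x (s p))) = g q (x (s q))" if "p \<in> A" "q \<in> A" "p \<le> q" for p q
      using g_natural[OF that el[OF x sB[OF that(1)]]] mor[OF x] sB s(2) that by simp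
    then show ?thesis
      using gx[OF x] by (auto simp: \<alpha>_def limit_space_def family_space_def)
  qed
  have factor: "limit_to_colimit K N B x = \<beta> (limit_to_colimit K M A (\<alpha> x))"
    if x: "x \<in> carrier (limit_space N B)" for x
  proof -
    have "\<beta> (limit_to_colimit K M A (\<alpha> x)) = \<beta> (colimit_map K M A p (g p (x (s p))))"
      using p by (simp add: M.limit_to_colimit_eq \<alpha>_def flip: p_def)
    also have "\<dots> = colimit_map K N B (t p) (f p (g p (x (s p))))"
      by (rule \<beta>_colimit_map[OF gx[OF x p]])
    also have "f p (g p (x (s p))) = x (t p)"
      using fg[OF p el[OF x sB[OF p]]] mor[OF x sB[OF p] tB[OF p] st[OF p]] by simp
    also have "colimit_map K N B (t p) (x (t p)) = limit_to_colimit K N B x"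
      using N.colimit_map_limit_eq[OF B x tB[OF p]] B_ne
      by (simp add: N.limit_to_colimit_eq some_in_eq)
    finally show ?thesis by simp
  qed
  show ?thesis
    unfolding gen_rank_def
    by (rule linear_rank_factor_le[OF M.vectorspace_limit M.vectorspace_colimit
          N.vectorspace_limit N.vectorspace_colimit M.limit_to_colimit_hom[OF A]
          N.limit_to_colimit_hom[OF B_ne] \<beta>_hom \<alpha> factor M.image_limit_to_colimit_fin_dim[OF A]])
qed

section \<open>Thickenings and interleavings\<close>

lemma infnorm_one: "infnorm (1 :: real ^ 'd) = 1"
  by (simp add: infnorm_cart)

lemma subset_thickening: "0 \<le> r \<Longrightarrow> I \<subseteq> thickening r I"
  by (force simp: thickening_def infnorm_0)

lemma thickening_diagonal_shift:
  fixes p :: "real ^ 'd"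
  assumes "p \<in> thickening \<delta> I" "\<bar>c\<bar> \<le> \<epsilon>"
  shows "p + c *\<^sub>R 1 \<in> thickening (\<epsilon> + \<delta>) I"
proof -
  obtain i where i: "i \<in> I" "infnorm (i - p) \<le> \<delta>"
    using assms(1) by (auto simp: thickening_def)
  have "infnorm (i - (p + c *\<^sub>R 1)) \<le> infnorm (i - p) + infnorm (- c *\<^sub>R (1 :: real ^ 'd))"
    using infnorm_triangle[of "i - p" "- c *\<^sub>R 1"] by (simp add: algebra_simps)
  also have "infnorm (- c *\<^sub>R (1 :: real ^ 'd)) = \<bar>c\<bar>"
    by (simp only: infnorm_mul infnorm_one abs_minus_cancel mult_1_right)
  finally show ?thesis using i assms(2) by (force simp: thickening_def)
qed

text \<open>
  A point \<open>q\<close> within distance \<open>r\<close> of \<open>i \<in> I\<close> lies below \<open>i + r(1,\<dots>,1)\<close>, which lies above \<open>i\<close> and still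
  belongs to the thickening. So every point is joined to \<open>I\<close> by two comparabilities.
\<close>

lemma thickening_connected:
  fixes I :: "(real ^ 'd) set"
  assumes I: "poset_connected I" and r: "0 \<le> r"
  shows "poset_connected (thickening r I)"
proof -
  let ?T = "thickening r I"
  let ?R = "\<lambda>x y. x \<in> ?T \<and> y \<in> ?T \<and> (x \<le> y \<or> y \<le> x)"
  have sym: "?R\<^sup>*\<^sup>* y x" if "?R\<^sup>*\<^sup>* x y" for x y
    using that by (induction) (auto intro: converse_rtranclp_into_rtranclp)
  have centre: "\<exists>i\<in>I. ?R\<^sup>*\<^sup>* q i" if q: "q \<in> ?T" for q
  proof -
    obtain i where i: "i \<in> I" "infnorm (i - q) \<le> r" using q by (auto simp: thickening_def)
    let ?j = "i + r *\<^sub>R 1"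
    have "i \<in> thickening 0 I" using subset_thickening[of 0 I] i(1) by auto
    from thickening_diagonal_shift[OF this, of r r] r have j: "?j \<in> ?T" by simp
    have iT: "i \<in> ?T" using subset_thickening[OF r] i(1) by auto
    have "q $ k \<le> ?j $ k" for k
      using component_le_infnorm_cart[of "i - q" k] i(2) by simp
    then have "q \<le> ?j" by (simp add: less_eq_vec_def)
    moreover have "i \<le> ?j" using r by (simp add: less_eq_vec_def)
    ultimately have qj: "?R q ?j" and ji: "?R ?j i" using q j iT by auto
    have "?R\<^sup>*\<^sup>* q i"
      by (rule rtranclp_trans[OF r_into_rtranclp[of ?R, OF qj] r_into_rtranclp[of ?R, OF ji]])
    with i(1) show ?thesis by blast
  qed
  have within: "?R\<^sup>*\<^sup>* i j" if "i \<in> I" "j \<in> I" for i j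
  proof (rule rtranclp_mono[THEN predicate2D])
    show "(\<lambda>x y. x \<in> I \<and> y \<in> I \<and> (x \<le> y \<or> y \<le> x))\<^sup>*\<^sup>* i j"
      using I that by (simp add: poset_connected_def)
  qed (use subset_thickening[OF r] in auto)
  show ?thesis
    unfolding poset_connected_def
  proof (intro ballI)
    fix p q assume "p \<in> ?T" "q \<in> ?T"
    then obtain i j where "i \<in> I" "j \<in> I" "?R\<^sup>*\<^sup>* p i" "?R\<^sup>*\<^sup>* q j"
      using centre by meson
    then show "?R\<^sup>*\<^sup>* p q" using within sym by (meson rtranclp_trans)
  qed
qed

text \<open>
  The diagonal shifts by \<open>-\<epsilon>\<close> and \<open>\<epsilon>\<close> serve as \<open>s\<close> and \<open>t\<close> above. The two composed maps of the
  interleaving give the internal map from \<open>p - \<epsilon>(1,\<dots>,1)\<close> to \<open>p + \<epsilon>(1,\<dots>,1)\<close>.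
\<close>

lemma gen_rank_le_of_interleaved:
  fixes M :: "(real ^ 'd, 'a, 'b) pers" and N :: "(real ^ 'd, 'a, 'c) pers"
  assumes M: "persistence_module K M" and N: "persistence_module K N"
    and \<epsilon>: "0 \<le> \<epsilon>" and inter: "interleaved K \<epsilon> M N"
    and A: "A \<noteq> {}" and B: "poset_connected B"
    and minus: "\<And>p. p \<in> A \<Longrightarrow> p - \<epsilon> *\<^sub>R 1 \<in> B"
    and plus: "\<And>p. p \<in> A \<Longrightarrow> p + \<epsilon> *\<^sub>R 1 \<in> B"
  shows "gen_rank K N B \<le> gen_rank K M A"
proof -
  let ?e = "\<epsilon> *\<^sub>R (1 :: real ^ 'd)"
  obtain f g where f: "natural_transformation K M (shift \<epsilon> N) f"
    and g: "natural_transformation K N (shift \<epsilon> M) g"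
    and fg: "\<And>p y. y \<in> carrier (obj N p) \<Longrightarrow>
      f (p + ?e) (g p y) = mor N p (p + (2 * \<epsilon>) *\<^sub>R 1) y"
    using inter by (auto simp: interleaved_def)
  have le: "p - ?e \<le> p + ?e" for p
    using \<epsilon> by (simp add: less_eq_vec_def)
  have mono: "p - ?e \<le> q - ?e" "p + ?e \<le> q + ?e" if "p \<le> q" for p q
    using that by (simp_all add: less_eq_vec_def)
  show ?thesis
  proof (rule gen_rank_le_of_factorization[OF M N A B, where s = "\<lambda>p. p - ?e" and t = "\<lambda>p. p + ?e"
        and g = "\<lambda>p. g (p - ?e)" and f = f])
    fix p
    show "g (p - ?e) \<in> module_hom K (obj N (p - ?e)) (obj M p)"
      using g by (auto simp: natural_transformation_def shift_def dest: spec[of _ "p - ?e"])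
    show "f p \<in> module_hom K (obj M p) (obj N (p + ?e))"
      using f by (simp add: natural_transformation_def shift_def)
    show "f p (g (p - ?e) y) = mor N (p - ?e) (p + ?e) y" if "y \<in> carrier (obj N (p - ?e))" for y
    proof -
      have "p - ?e + (2 * \<epsilon>) *\<^sub>R 1 = p + ?e"
        unfolding mult_2 scaleR_left_distrib by simp
      then show ?thesis using fg[OF that] by (simp only: diff_add_cancel)
    qed
    fix q assume pq: "p \<le> q"
    show "g (q - ?e) (mor N (p - ?e) (q - ?e) y) = mor M p q (g (p - ?e) y)"
      if "y \<in> carrier (obj N (p - ?e))" for y
      using g mono(1)[OF pq] that by (simp add: natural_transformation_def shift_def)
    show "f q (mor M p q x) = mor N (p + ?e) (q + ?e) (f p x)" if "x \<in> carrier (obj M p)" for x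
      using f pq that by (simp add: natural_transformation_def shift_def)
  qed (use minus plus le mono in \<open>auto simp: inj_on_def\<close>)
qed

lemma interleaved_sym: "interleaved K \<epsilon> M N \<longleftrightarrow> interleaved K \<epsilon> N M"
  unfolding interleaved_def by blast

text \<open>
  The amount \<open>\<epsilon>'\<close> of thickening may exceed the interleaving parameter \<open>\<epsilon>\<close>. This covers \<open>\<epsilon> = 0\<close>, which is
  admitted in the interleaving distance but not in the erosion distance, without enlarging the
  interleaving itself.
\<close>

lemma gen_rank_thickening_le:
  fixes M :: "(real ^ 'd, 'a, 'b) pers" and N :: "(real ^ 'd, 'a, 'c) pers"
  assumes M: "persistence_module K M" and N: "persistence_module K N"
    and \<epsilon>: "0 \<le> \<epsilon>" "\<epsilon> \<le> \<epsilon>'" and inter: "interleaved K \<epsilon> M N"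
    and I: "I \<noteq> {}" "poset_connected I" and \<delta>: "0 \<le> \<delta>"
  shows "gen_rank K N (thickening (\<epsilon>' + \<delta>) I) \<le> gen_rank K M (thickening \<delta> I)"
proof (rule gen_rank_le_of_interleaved[OF M N \<epsilon>(1) inter])
  show "thickening \<delta> I \<noteq> {}" using subset_thickening[OF \<delta>] I(1) by blast
  show "poset_connected (thickening (\<epsilon>' + \<delta>) I)" using thickening_connected[OF I(2)] \<epsilon> \<delta> by simp
  fix p assume "p \<in> thickening \<delta> I"
  from thickening_diagonal_shift[OF this, of "- \<epsilon>" \<epsilon>'] thickening_diagonal_shift[OF this, of \<epsilon> \<epsilon>'] \<epsilon>
  show "p - \<epsilon> *\<^sub>R 1 \<in> thickening (\<epsilon>' + \<delta>) I" "p + \<epsilon> *\<^sub>R 1 \<in> thickening (\<epsilon>' + \<delta>) I" by simp_all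
qed

theorem corollary7:
  fixes K :: "('a, 'm) ring_scheme"
    and M :: "(real ^ 'd, 'a, 'b) pers"
    and N :: "(real ^ 'd, 'a, 'c) pers"
    and \<I> :: "(real ^ 'd) set set"
  assumes "persistence_module K M" and "persistence_module K N"
    and "finitely_presentable K M" and "finitely_presentable K N"
    and "\<I> \<noteq> {}" and "\<I> \<subseteq> Intervals"
  shows "sparse_erosion_distance (gen_rank K M, \<I>) (gen_rank K N, \<I>)
           \<le> interleaving_distance K M N"
  unfolding interleaving_distance_def
proof (rule Inf_greatest, clarify)
  fix \<epsilon> :: real assume \<epsilon>: "0 \<le> \<epsilon>" and inter: "interleaved K \<epsilon> M N"
  have "sparse_erosion_distance (gen_rank K M, \<I>) (gen_rank K N, \<I>) \<le> ereal (\<epsilon> + e)"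
    if e: "0 < e" for e
  proof -
    have "eps_correspondence (\<epsilon> + e) \<I> \<I> ((\<lambda>I. (I, I)) ` \<I>)"
      using subset_thickening[of "\<epsilon> + e"] \<epsilon> e
      by (auto simp: eps_correspondence_def correspondence_def image_image)
    moreover have "gen_rank K N (thickening (\<epsilon> + e + \<delta>) I) \<le> gen_rank K M (thickening \<delta> I)"
      "gen_rank K M (thickening (\<epsilon> + e + \<delta>) I) \<le> gen_rank K N (thickening \<delta> I)"
      if "I \<in> \<I>" "0 \<le> \<delta>" for I \<delta>
      using that assms(6) e
      by (auto simp: Intervals_def intro!: gen_rank_thickening_le[OF assms(1,2) \<epsilon> _ inter]
          gen_rank_thickening_le[OF assms(2,1) \<epsilon> _ inter[unfolded interleaved_sym[of K \<epsilon> M N]]])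
    ultimately show ?thesis
      unfolding sparse_erosion_distance_def prod.case using \<epsilon> e
      by (intro Inf_lower CollectI exI[of _ "\<epsilon> + e"] conjI exI[of _ "(\<lambda>I. (I, I)) ` \<I>"]) auto
  qed
  then show "sparse_erosion_distance (gen_rank K M, \<I>) (gen_rank K N, \<I>) \<le> ereal \<epsilon>"
    by - (rule ereal_le_epsilon2, simp)
qed

end
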